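(* Let $H$ be a linearly orderable monoid. Then: (i) $|XY| \ge |X| + |Y| - 1$ for all $X, Y \in \mathcal P_{\rm fin}(H)$. (ii) $\mathcal P_{\rm fin}(H)$ and $\mathcal P_{{\rm fin},\times}(H)$ are strongly unit-cancellative monoids. (iii) The function $\lambda_\times: \mathcal P_{{\rm fin},\times}(H) \to \mathbf N$, $X \mapsto |X|-1$, is a length function, and $\mathcal P_{{\rm fin},\times}(H)$ is a BF-monoid. (iv) $\mathcal P_{\rm fin}(H)$ is a BF-monoid if and only if so is $H$.
   Context: Monoids are written multiplicatively and need not be commutative or cancellative; for a monoid $M$, $M^\times$ is its set of units; $\mathbf N$ (resp. $\mathbf N^+$) is the set of non-negative (resp. positive) integers. A monoid $H$ is linearly orderable if there is a total order $\preceq$ on $H$ such that $xz\prec yz$ and $zx\prec zy$ for all $x,y,z\in H$ with $x\prec y$. $\mathcal P_{\rm fin}(H)$ (the power monoid of $H$) is the set of all non-empty finite subsets of $H$ with operation $XY := \{xy: x\in X, y\in Y\}$ and identity $\{1_H\}$; $\mathcal P_{{\rm fin},\times}(H)$ (the restricted power monoid) is its submonoid $\{X\in\mathcal P_{\rm fin}(H): X\cap H^\times\ne\emptyset\}$. A monoid $M$ is strongly unit-cancellative if, for $x,y\in M$, $xy=x$ or $yx=x$ implies $y=1_M$. A length function on $M$ is a function $\lambda: M\to\mathbf N$ with $\lambda(x)<\lambda(y)$ for all $x,y\in M$ such that $y=uxv$ for some $u,v\in M$ with $u\notin M^\times$ or $v\notin M^\times$. An atom of $M$ is an element $a\notin M^\times$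 such that there are no $x,y\in M\setminus M^\times$ with $a=xy$. $M$ is a BF-monoid if for every $x\in M\setminus M^\times$ the set $\mathsf L_M(x)$ of all $k\in\mathbf N^+$ such that $x$ is a product of $k$ atoms of $M$ is non-empty and finite. *)

theory Defs
  imports "HOL-Algebra.Coset"
begin

definition linearly_orderable :: "('a, 'b) monoid_scheme \<Rightarrow> bool" where
  "linearly_orderable H \<longleftrightarrow>
     (\<exists>r. linear_order_on (carrier H) r \<and>
          (\<forall>x \<in> carrier H. \<forall>y \<in> carrier H. \<forall>z \<in> carrier H.
             (x, y) \<in> r \<and> x \<noteq> y \<longrightarrow>
               ((x \<otimes>\<^bsub>H\<^esub> z, y \<otimes>\<^bsub>H\<^esub> z) \<in> r \<and> x \<otimes>\<^bsub>H\<^esub> z \<noteq> y \<otimes>\<^bsub>H\<^esub> z) \<and>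
               ((z \<otimes>\<^bsub>H\<^esub> x, z \<otimes>\<^bsub>H\<^esub> y) \<in> r \<and> z \<otimes>\<^bsub>H\<^esub> x \<noteq> z \<otimes>\<^bsub>H\<^esub> y)))"

definition power_monoid :: "('a, 'b) monoid_scheme \<Rightarrow> 'a set monoid" where
  "power_monoid H =
     \<lparr>carrier = {X. X \<subseteq> carrier H \<and> finite X \<and> X \<noteq> {}},
      mult = (\<lambda>X Y. X <#>\<^bsub>H\<^esub> Y),
      one = {\<one>\<^bsub>H\<^esub>}\<rparr>"

definition restricted_power_monoid :: "('a, 'b) monoid_scheme \<Rightarrow> 'a set monoid" where
  "restricted_power_monoid H =
     (power_monoid H)\<lparr>carrier := {X \<in> carrier (power_monoid H). X \<inter> Units H \<noteq> {}}\<rparr>"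

definition strongly_unit_cancellative :: "('a, 'b) monoid_scheme \<Rightarrow> bool" where
  "strongly_unit_cancellative M \<longleftrightarrow>
     (\<forall>x \<in> carrier M. \<forall>y \<in> carrier M.
        x \<otimes>\<^bsub>M\<^esub> y = x \<or> y \<otimes>\<^bsub>M\<^esub> x = x \<longrightarrow> y = \<one>\<^bsub>M\<^esub>)"

definition length_function :: "('a, 'b) monoid_scheme \<Rightarrow> ('a \<Rightarrow> nat) \<Rightarrow> bool" where
  "length_function M f \<longleftrightarrow>
     (\<forall>x \<in> carrier M. \<forall>y \<in> carrier M.
        (\<exists>u \<in> carrier M. \<exists>v \<in> carrier M.
           y = u \<otimes>\<^bsub>M\<^esub> x \<otimes>\<^bsub>M\<^esub> v \<and> (u \<notin> Units M \<or> v \<notin> Units M))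
        \<longrightarrow> f x < f y)"

text \<open>The predicate \<open>irreducible\<close> of \<open>HOL-Algebra.Divisibility\<close> is phrased through one-sided
  divisibility and is not used here, since the monoids need not be commutative or cancellative.\<close>

definition atoms :: "('a, 'b) monoid_scheme \<Rightarrow> 'a set" where
  "atoms M = {a \<in> carrier M - Units M.
     \<not> (\<exists>x \<in> carrier M - Units M. \<exists>y \<in> carrier M - Units M. a = x \<otimes>\<^bsub>M\<^esub> y)}"

definition length_set :: "('a, 'b) monoid_scheme \<Rightarrow> 'a \<Rightarrow> nat set" where
  "length_set M x =
     {k. k > 0 \<and>
         (\<exists>as. length as = k \<and> set as \<subseteq> atoms M \<and> foldr (\<otimes>\<^bsub>M\<^esub>) as \<one>\<^bsub>M\<^esub> = x)}"

definition BF_monoid :: "('a, 'b) monoid_scheme \<Rightarrow> bool" where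
  "BF_monoid M \<longleftrightarrow>
     monoid M \<and>
     (\<forall>x \<in> carrier M - Units M. length_set M x \<noteq> {} \<and> finite (length_set M x))"

end

theory Submission
  imports Defs "HOL-Algebra.Divisibility"
begin

text \<open>A monoid carrying a superadditive \<open>\<nat>\<close>-valued function that is positive off the units is BF,
  since such a function bounds factorization lengths and drops on passing to proper factors.
  Conversely, if only units divide units, the largest factorization length of a BF-monoid is such
  a function. On the restricted power monoid one can take \<open>\<lambda>X. card X - 1\<close>, by the bound
  \<open>card (XY) \<ge> card X + card Y - 1\<close> (compare \<open>X\<close> multiplied by the minimum of \<open>Y\<close> with \<open>Y\<close> multiplied
  by the maximum of \<open>X\<close>). On the full power monoid, given such a function \<open>f\<close> on \<open>H\<close>, one takes
  \<open>\<lambda>X. card X - 1 + f (min X)\<close>, because \<open>min (XY) = min X min Y\<close>; and a function on the power monoid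
  restricts to singletons.\<close>

section \<open>Superadditive lengths\<close>

text \<open>This condition serves both to bound factorization lengths and to pass between
  \<open>H\<close> and its power monoid. Its clauses force the value 0 exactly at the units:
  \<open>f \<one> + f \<one> \<le> f \<one>\<close> gives \<open>f \<one> = 0\<close>, and then
  \<open>f u + f (inv u) \<le> 0\<close>.\<close>

definition superadditive_length :: "('a, 'b) monoid_scheme \<Rightarrow> ('a \<Rightarrow> nat) \<Rightarrow> bool" where
  "superadditive_length M f \<longleftrightarrow>
     (\<forall>x \<in> carrier M. \<forall>y \<in> carrier M. f x + f y \<le> f (x \<otimes>\<^bsub>M\<^esub> y)) \<and>
     (\<forall>x \<in> carrier M - Units M. 0 < f x)"

lemma superadditive_lengthD:
  assumes "superadditive_length M f"
  shows "\<lbrakk>x \<in> carrier M; y \<in> carrier M\<rbrakk> \<Longrightarrow> f x + f y \<le> f (x \<otimes>\<^bsub>M\<^esub> y)"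
    and "\<lbrakk>x \<in> carrier M; x \<notin> Units M\<rbrakk> \<Longrightarrow> 0 < f x"
  using assms by (auto simp: superadditive_length_def)

context monoid
begin

lemma superadditive_length_imp_length_function:
  assumes f: "superadditive_length G f"
  shows "length_function G f"
  unfolding length_function_def
proof (intro ballI impI, elim bexE conjE)
  fix x y u v
  assume carr: "x \<in> carrier G" "u \<in> carrier G" "v \<in> carrier G"
    and y: "y = u \<otimes> x \<otimes> v" and nonunit: "u \<notin> Units G \<or> v \<notin> Units G"
  have "f u + f x + f v \<le> f y"
    using superadditive_lengthD(1)[OF f, of u x] superadditive_lengthD(1)[OF f, of "u \<otimes> x" v]
      carr y by simp
  moreover have "0 < f u + f v"
    using nonunit superadditive_lengthD(2)[OF f carr(2)] superadditive_lengthD(2)[OF f carr(3)]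
    by auto
  ultimately show "f x < f y" by linarith
qed

section \<open>Factorizations into atoms and their lengths\<close>

lemma foldr_mult_append:
  assumes "set as \<subseteq> carrier G" "set bs \<subseteq> carrier G"
  shows "foldr (\<otimes>) (as @ bs) \<one> = foldr (\<otimes>) as \<one> \<otimes> foldr (\<otimes>) bs \<one>"
  using assms by (induction as) (auto simp: m_assoc)

lemma atoms_closed: "atoms G \<subseteq> carrier G"
  by (auto simp: atoms_def)

lemma atom_in_length_set: "a \<in> atoms G \<Longrightarrow> 1 \<in> length_set G a"
  using atoms_closed by (auto simp: length_set_def intro!: exI[of _ "[a]"])

lemma length_set_mult:
  assumes "k \<in> length_set G x" "l \<in> length_set G y"
  shows "k + l \<in> length_set G (x \<otimes> y)"
proof -
  obtain as bs where as: "length as = k" "set as \<subseteq> atoms G" "foldr (\<otimes>) as \<one> = x" "k > 0"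
    and bs: "length bs = l" "set bs \<subseteq> atoms G" "foldr (\<otimes>) bs \<one> = y"
    using assms by (auto simp: length_set_def)
  have "foldr (\<otimes>) (as @ bs) \<one> = x \<otimes> y"
    using foldr_mult_append as bs atoms_closed by blast
  then show ?thesis
    using as bs by (auto simp: length_set_def intro!: exI[of _ "as @ bs"])
qed

text \<open>Atoms are nonunits, so each of them contributes at least 1 to the value of the
  product.\<close>

lemma length_le_superadditive_length:
  assumes f: "superadditive_length G f" and as: "set as \<subseteq> atoms G"
  shows "length as \<le> f (foldr (\<otimes>) as \<one>)"
  using as
proof (induction as)
  case (Cons a as)
  have "0 < f a"
    using Cons.prems superadditive_lengthD(2)[OF f] by (auto simp: atoms_def)
  moreover have "f a + f (foldr (\<otimes>) as \<one>) \<le> f (a \<otimes> foldr (\<otimes>) as \<one>)"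
    using Cons.prems atoms_closed by (intro superadditive_lengthD(1)[OF f] multlist_closed) auto
  ultimately show ?case
    using Cons by simp
qed simp

lemma superadditive_length_imp_BF:
  assumes f: "superadditive_length G f"
  shows "BF_monoid G"
proof -
  have "finite (length_set G x)" for x
    by (rule finite_subset[of _ "{..f x}"])
      (use length_le_superadditive_length[OF f] in \<open>auto simp: length_set_def\<close>)
  moreover have "length_set G x \<noteq> {}" if "x \<in> carrier G - Units G" for x
    using that
  \<comment> \<open>When a non-atom splits into two nonunits, both values are positive, so
    superadditivity makes each strictly smaller than \<open>f x\<close>.\<close>
  proof (induction "f x" arbitrary: x rule: less_induct)
    case less
    show ?case
    proof (cases "x \<in> atoms G")
      case True
      then show ?thesis using atom_in_length_set by blast
    next
      case False
      then obtain y z where yz: "y \<in> carrier G - Units G" "z \<in> carrier G - Units G" "x = y \<otimes> z"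
        using less.prems by (auto simp: atoms_def)
      then have "f y + f z \<le> f x" "0 < f y" "0 < f z"
        using superadditive_lengthD[OF f] by auto
      then have "length_set G y \<noteq> {}" "length_set G z \<noteq> {}"
        using yz less.hyps by auto
      then show ?thesis
        using length_set_mult yz(3) by blast
    qed
  qed
  ultimately show ?thesis
    unfolding BF_monoid_def using monoid_axioms by auto
qed

section \<open>Multiplication by units and factorization lengths\<close>

lemma unit_mult_nonunit:
  assumes "u \<in> Units G" "x \<in> carrier G - Units G"
  shows "u \<otimes> x \<in> carrier G - Units G"
proof -
  have "inv u \<otimes> (u \<otimes> x) = x"
    using assms by (simp add: m_assoc[symmetric] Units_closed)
  then show ?thesis
    using assms Units_m_closed[of "inv u" "u \<otimes> x"] by (auto simp: Units_closed)
qed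

lemma nonunit_mult_unit:
  assumes "u \<in> Units G" "x \<in> carrier G - Units G"
  shows "x \<otimes> u \<in> carrier G - Units G"
proof -
  have "(x \<otimes> u) \<otimes> inv u = x"
    using assms by (simp add: m_assoc Units_closed)
  then show ?thesis
    using assms Units_m_closed[of "x \<otimes> u" "inv u"] by (auto simp: Units_closed)
qed

text \<open>A splitting of \<open>u \<otimes> a\<close> into nonunits becomes one of
  \<open>a\<close> once \<open>inv u\<close> is absorbed into the left factor, which stays a
  nonunit.\<close>

lemma unit_mult_atom:
  assumes u: "u \<in> Units G" and a: "a \<in> atoms G"
  shows "u \<otimes> a \<in> atoms G"
proof -
  have nonunit: "a \<in> carrier G - Units G"
    using a by (simp add: atoms_def)
  have False if yz: "y \<in> carrier G - Units G" "z \<in> carrier G - Units G" "u \<otimes> a = y \<otimes> z" for y z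
  proof -
    have "inv u \<otimes> (u \<otimes> a) = a"
      using u nonunit by (simp add: m_assoc[symmetric] Units_closed)
    then have "a = (inv u \<otimes> y) \<otimes> z"
      using yz u by (simp add: m_assoc Units_closed)
    then show False
      using a yz(1,2) unit_mult_nonunit[of "inv u" y] u by (auto simp: atoms_def)
  qed
  then show ?thesis
    using unit_mult_nonunit[OF u nonunit] by (auto simp: atoms_def)
qed

lemma atom_mult_unit:
  assumes u: "u \<in> Units G" and a: "a \<in> atoms G"
  shows "a \<otimes> u \<in> atoms G"
proof -
  have nonunit: "a \<in> carrier G - Units G"
    using a by (simp add: atoms_def)
  have False if yz: "y \<in> carrier G - Units G" "z \<in> carrier G - Units G" "a \<otimes> u = y \<otimes> z" for y z
  proof -
    have "(a \<otimes> u) \<otimes> inv u = a"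
      using u nonunit by (simp add: m_assoc Units_closed)
    then have "a = y \<otimes> (z \<otimes> inv u)"
      using yz u by (simp add: m_assoc Units_closed)
    then show False
      using a yz(1,2) nonunit_mult_unit[of "inv u" z] u by (auto simp: atoms_def)
  qed
  then show ?thesis
    using nonunit_mult_unit[OF u nonunit] by (auto simp: atoms_def)
qed

text \<open>The unit is absorbed by the first atom, which exists because lengths are positive; the
  number of atoms is unchanged.\<close>

lemma length_set_unit_mult:
  assumes u: "u \<in> Units G"
  shows "length_set G x \<subseteq> length_set G (u \<otimes> x)"
proof
  fix k assume "k \<in> length_set G x"
  then obtain a as where as: "Suc (length as) = k" "a \<in> atoms G" "set as \<subseteq> atoms G"
      "x = a \<otimes> foldr (\<otimes>) as \<one>"
    by (auto simp: length_set_def gr0_conv_Suc length_Suc_conv)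
  then have "a \<in> carrier G" "foldr (\<otimes>) as \<one> \<in> carrier G"
    using atoms_closed by (auto intro!: multlist_closed)
  then have "foldr (\<otimes>) ((u \<otimes> a) # as) \<one> = u \<otimes> x"
    using u as by (simp add: m_assoc Units_closed)
  then show "k \<in> length_set G (u \<otimes> x)"
    using as unit_mult_atom[OF u] by (auto simp: length_set_def intro!: exI[of _ "(u \<otimes> a) # as"])
qed

text \<open>Here the last atom absorbs the unit, so the nonempty list is split from its end.\<close>

lemma length_set_mult_unit:
  assumes u: "u \<in> Units G"
  shows "length_set G x \<subseteq> length_set G (x \<otimes> u)"
proof
  fix k assume "k \<in> length_set G x"
  then obtain cs where cs: "length cs = k" "k > 0" "set cs \<subseteq> atoms G" "foldr (\<otimes>) cs \<one> = x"
    by (auto simp: length_set_def)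
  then obtain as a where as: "cs = as @ [a]"
    by (cases cs rule: rev_cases) auto
  have carr: "set as \<subseteq> carrier G" "a \<in> carrier G"
    using as cs atoms_closed by auto
  then have "x = foldr (\<otimes>) as \<one> \<otimes> a"
    using foldr_mult_append[of as "[a]"] as cs by simp
  then have "foldr (\<otimes>) (as @ [a \<otimes> u]) \<one> = x \<otimes> u"
    using carr u foldr_mult_append[of as "[a \<otimes> u]"] by (simp add: m_assoc Units_closed)
  then show "k \<in> length_set G (x \<otimes> u)"
    using as cs atom_mult_unit[OF u]
    by (auto simp: length_set_def simp del: foldr_append intro!: exI[of _ "as @ [a \<otimes> u]"])
qed

text \<open>Longest factorizations of \<open>x\<close> and \<open>y\<close> combine into a
  factorization of \<open>x \<otimes> y\<close>, whose length is at most the maximum. The assumption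
  on units settles unit products, where both summands must vanish.\<close>

lemma BF_imp_superadditive_length:
  assumes BF: "BF_monoid G"
    and units: "\<And>x y. \<lbrakk>x \<in> carrier G; y \<in> carrier G; x \<otimes> y \<in> Units G\<rbrakk>
                  \<Longrightarrow> x \<in> Units G \<and> y \<in> Units G"
  shows "\<exists>f. superadditive_length G f"
proof -
  \<comment> \<open>Units get 0 separately: under the assumption on units their length sets are
    empty, and \<open>Max\<close> of the empty set carries no information.\<close>
  define f where "f x = (if x \<in> Units G then 0 else Max (length_set G x))" for x
  have L: "length_set G x \<noteq> {}" "finite (length_set G x)" if "x \<in> carrier G" "x \<notin> Units G" for x
    using BF that by (auto simp: BF_monoid_def)
  have f_mem: "f x \<in> length_set G x" if "x \<in> carrier G" "x \<notin> Units G" for x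
    using L[OF that] that by (simp add: f_def)
  have le_f: "k \<le> f x" if "k \<in> length_set G x" "x \<in> carrier G" "x \<notin> Units G" for k x
    using L[OF that(2,3)] that by (simp add: f_def)
  have "f x + f y \<le> f (x \<otimes> y)" if xy: "x \<in> carrier G" "y \<in> carrier G" for x y
  proof (cases "x \<otimes> y \<in> Units G")
    case True
    then show ?thesis using units[OF xy] by (simp add: f_def)
  next
    case nonunit: False
    \<comment> \<open>A unit factor contributes 0 and is absorbed by an atom of the other factor;
      two nonunit factors have their factorizations concatenated.\<close>
    have "f x + f y \<in> length_set G (x \<otimes> y)"
    proof (cases "x \<in> Units G")
      case x: True
      then have "y \<notin> Units G" using nonunit by auto
      then show ?thesis
        using f_mem[of y] xy length_set_unit_mult[OF x, of y] x by (auto simp: f_def)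
    next
      case x: False
      show ?thesis
      proof (cases "y \<in> Units G")
        case y: True
        then show ?thesis
          using f_mem[of x] xy length_set_mult_unit[OF y, of x] x by (auto simp: f_def)
      next
        case False
        then show ?thesis using length_set_mult f_mem x xy by auto
      qed
    qed
    then show ?thesis using le_f nonunit xy by simp
  qed
  moreover have "0 < f x" if "x \<in> carrier G - Units G" for x
    using f_mem[of x] that by (auto simp: length_set_def)
  ultimately show ?thesis
    unfolding superadditive_length_def by blast
qed

section \<open>Power monoids\<close>

lemma set_mult_singletons [simp]: "{x} <#> {y} = {x \<otimes> y}"
  by (simp add: set_mult_def)

lemma finite_set_mult: "\<lbrakk>finite X; finite Y\<rbrakk> \<Longrightarrow> finite (X <#> Y)"
  by (simp add: set_mult_def)

lemma set_mult_assoc':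
  assumes "X \<subseteq> carrier G" "Y \<subseteq> carrier G" "Z \<subseteq> carrier G"
  shows "(X <#> Y) <#> Z = X <#> (Y <#> Z)"
proof -
  have "(x \<otimes> y) \<otimes> z = x \<otimes> (y \<otimes> z)" if "x \<in> X" "y \<in> Y" "z \<in> Z" for x y z
    using assms that by (simp add: m_assoc subset_iff)
  then show ?thesis
    unfolding set_mult_def by auto
qed

lemma carrier_power_monoid:
  "X \<in> carrier (power_monoid G) \<longleftrightarrow> X \<subseteq> carrier G \<and> finite X \<and> X \<noteq> {}"
  by (simp add: power_monoid_def)

lemma carrier_restricted_power_monoid:
  "X \<in> carrier (restricted_power_monoid G) \<longleftrightarrow>
     X \<in> carrier (power_monoid G) \<and> X \<inter> Units G \<noteq> {}"
  by (simp add: restricted_power_monoid_def)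

lemma power_monoid_simps [simp]:
  "monoid.mult (power_monoid G) = (<#>)" "monoid.one (power_monoid G) = {\<one>}"
  "monoid.mult (restricted_power_monoid G) = (<#>)" "monoid.one (restricted_power_monoid G) = {\<one>}"
  by (auto simp: power_monoid_def restricted_power_monoid_def fun_eq_iff)

lemma singleton_in_power_monoid: "{x} \<in> carrier (power_monoid G) \<longleftrightarrow> x \<in> carrier G"
  by (simp add: carrier_power_monoid)

lemma monoid_power_monoid: "monoid (power_monoid G)"
proof
  fix X Y assume "X \<in> carrier (power_monoid G)" "Y \<in> carrier (power_monoid G)"
  then show "X \<otimes>\<^bsub>power_monoid G\<^esub> Y \<in> carrier (power_monoid G)"
    using finite_set_mult set_mult_closed by (auto simp: carrier_power_monoid set_mult_def)
next
  fix X assume "X \<in> carrier (power_monoid G)"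
  then have "X \<subseteq> carrier G" by (simp add: carrier_power_monoid)
  then show "\<one>\<^bsub>power_monoid G\<^esub> \<otimes>\<^bsub>power_monoid G\<^esub> X = X"
    and "X \<otimes>\<^bsub>power_monoid G\<^esub> \<one>\<^bsub>power_monoid G\<^esub> = X"
    by (auto simp: set_mult_def subset_iff)
qed (auto simp: carrier_power_monoid set_mult_assoc')

lemma monoid_restricted_power_monoid: "monoid (restricted_power_monoid G)"
proof -
  interpret P: monoid "power_monoid G" by (rule monoid_power_monoid)
  \<comment> \<open>Closure holds because a unit in \<open>X\<close> times a unit in
    \<open>Y\<close> is a unit in \<open>X <#> Y\<close>.\<close>
  have "submonoid {X \<in> carrier (power_monoid G). X \<inter> Units G \<noteq> {}} (power_monoid G)"
  proof
    fix X Y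
    assume XY: "X \<in> {X \<in> carrier (power_monoid G). X \<inter> Units G \<noteq> {}}"
      "Y \<in> {X \<in> carrier (power_monoid G). X \<inter> Units G \<noteq> {}}"
    then obtain u v where "u \<in> X" "v \<in> Y" "u \<in> Units G" "v \<in> Units G" by auto
    then have "u \<otimes> v \<in> (X <#> Y) \<inter> Units G"
      by (auto simp: set_mult_def)
    then show "X \<otimes>\<^bsub>power_monoid G\<^esub> Y \<in> {X \<in> carrier (power_monoid G). X \<inter> Units G \<noteq> {}}"
      using P.m_closed[of X Y] XY by auto
  qed (auto simp: singleton_in_power_monoid)
  from submonoid.submonoid_is_monoid[OF this monoid_power_monoid] show ?thesis
    by (simp add: restricted_power_monoid_def)
qed

text \<open>The inverse is \<open>{inv u}\<close>, which again meets the units and so lies in the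
  restricted power monoid as well.\<close>

lemma singleton_unit_power_monoid:
  assumes "u \<in> Units G"
  shows "{u} \<in> Units (power_monoid G)" "{u} \<in> Units (restricted_power_monoid G)"
  using assms unfolding Units_def[of "power_monoid G"] Units_def[of "restricted_power_monoid G"]
  by (auto simp: singleton_in_power_monoid carrier_restricted_power_monoid Units_closed
      intro!: bexI[of _ "{inv u}"])

end

section \<open>Linearly ordered monoids\<close>

locale linearly_ordered_monoid = monoid H for H (structure) +
  fixes r :: "'a rel"
  assumes linear: "linear_order_on (carrier H) r"
    and mult_right: "\<lbrakk>x \<in> carrier H; y \<in> carrier H; z \<in> carrier H; (x, y) \<in> r; x \<noteq> y\<rbrakk>
                      \<Longrightarrow> (x \<otimes> z, y \<otimes> z) \<in> r \<and> x \<otimes> z \<noteq> y \<otimes> z"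
    and mult_left: "\<lbrakk>x \<in> carrier H; y \<in> carrier H; z \<in> carrier H; (x, y) \<in> r; x \<noteq> y\<rbrakk>
                      \<Longrightarrow> (z \<otimes> x, z \<otimes> y) \<in> r \<and> z \<otimes> x \<noteq> z \<otimes> y"
begin

text \<open>Reversing the order turns maxima into least elements, so that the theory of
  \<open>least\<close> covers both.\<close>

lemma linearly_ordered_converse: "linearly_ordered_monoid H (r\<inverse>)"
  using linear mult_right mult_left
  by unfold_locales (auto, metis+)

section \<open>Order, cancellation and units\<close>

lemma le_refl: "x \<in> carrier H \<Longrightarrow> (x, x) \<in> r"
  using linear by (auto simp: order_on_defs refl_on_def)

lemma le_antisym: "\<lbrakk>(x, y) \<in> r; (y, x) \<in> r\<rbrakk> \<Longrightarrow> x = y"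
  using linear by (auto simp: order_on_defs antisym_def)

lemma le_trans: "\<lbrakk>(x, y) \<in> r; (y, z) \<in> r\<rbrakk> \<Longrightarrow> (x, z) \<in> r"
  using linear by (auto simp: order_on_defs trans_def)

lemma le_linear: "\<lbrakk>x \<in> carrier H; y \<in> carrier H\<rbrakk> \<Longrightarrow> (x, y) \<in> r \<or> (y, x) \<in> r"
  using linear le_refl unfolding order_on_defs total_on_def by metis

lemma right_mono:
  "\<lbrakk>x \<in> carrier H; y \<in> carrier H; z \<in> carrier H; (x, y) \<in> r\<rbrakk> \<Longrightarrow> (x \<otimes> z, y \<otimes> z) \<in> r"
  using mult_right le_refl by (cases "x = y") auto

lemma left_mono:
  "\<lbrakk>x \<in> carrier H; y \<in> carrier H; z \<in> carrier H; (x, y) \<in> r\<rbrakk> \<Longrightarrow> (z \<otimes> x, z \<otimes> y) \<in> r"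
  using mult_left le_refl by (cases "x = y") auto

text \<open>Distinct elements are comparable by totality, and strict monotonicity keeps their
  products distinct.\<close>

lemma right_cancel:
  "\<lbrakk>x \<in> carrier H; y \<in> carrier H; z \<in> carrier H; x \<otimes> z = y \<otimes> z\<rbrakk> \<Longrightarrow> x = y"
  using mult_right le_linear by metis

lemma left_cancel:
  "\<lbrakk>x \<in> carrier H; y \<in> carrier H; z \<in> carrier H; z \<otimes> x = z \<otimes> y\<rbrakk> \<Longrightarrow> x = y"
  using mult_left le_linear by metis

text \<open>Since \<open>x \<otimes> (y \<otimes> x) = (x \<otimes> y) \<otimes> x = x\<close>,
  cancelling \<open>x\<close> makes a one-sided inverse two-sided.\<close>

lemma mult_eq_one_commute:
  assumes "x \<in> carrier H" "y \<in> carrier H" "x \<otimes> y = \<one>"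
  shows "y \<otimes> x = \<one>"
proof (rule left_cancel[of _ _ x])
  show "x \<otimes> (y \<otimes> x) = x \<otimes> \<one>"
    using assms by (simp add: m_assoc[symmetric])
qed (use assms in auto)

text \<open>The inverse of \<open>x \<otimes> y\<close> yields a right inverse of \<open>x\<close>
  and a left inverse of \<open>y\<close>, and one-sided inverses are two-sided here. This is the
  assumption on units in \<open>BF_imp_superadditive_length\<close>.\<close>

lemma units_of_mult_unit:
  assumes xy: "x \<in> carrier H" "y \<in> carrier H" and u: "x \<otimes> y \<in> Units H"
  shows "x \<in> Units H \<and> y \<in> Units H"
proof -
  have "x \<otimes> (y \<otimes> inv (x \<otimes> y)) = \<one>" "(inv (x \<otimes> y) \<otimes> x) \<otimes> y = \<one>"
    using xy Units_r_inv[OF u] Units_l_inv[OF u] Units_inv_closed[OF u]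
    by (simp_all only: m_assoc m_closed)
  moreover have "y \<otimes> inv (x \<otimes> y) \<in> carrier H" "inv (x \<otimes> y) \<otimes> x \<in> carrier H"
    using xy u by auto
  ultimately show ?thesis
    using xy mult_eq_one_commute unfolding Units_def by blast
qed

text \<open>The order \<open>r\<close> is a relation on the carrier and not an order on the type, so
  minima are taken relative to \<open>r\<close>.\<close>

definition is_least :: "'a \<Rightarrow> 'a set \<Rightarrow> bool" where
  "is_least m X \<longleftrightarrow> m \<in> X \<and> (\<forall>x \<in> X. (m, x) \<in> r)"

definition least :: "'a set \<Rightarrow> 'a" where
  "least X = (THE m. is_least m X)"

lemma is_least_unique: "\<lbrakk>is_least m X; is_least n X\<rbrakk> \<Longrightarrow> m = n"
  by (auto simp: is_least_def intro: le_antisym)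

lemma least_eqI: "is_least m X \<Longrightarrow> least X = m"
  unfolding least_def using is_least_unique by blast

lemma ex_is_least:
  assumes "finite X" "X \<noteq> {}" "X \<subseteq> carrier H"
  shows "\<exists>m. is_least m X"
  using assms
proof (induction rule: finite_ne_induct)
  case (singleton x)
  then show ?case by (auto simp: is_least_def le_refl)
next
  case (insert x X)
  then obtain m where m: "is_least m X" by auto
  then have "m \<in> carrier H" "x \<in> carrier H"
    using insert.prems by (auto simp: is_least_def)
  then consider "(m, x) \<in> r" | "(x, m) \<in> r"
    using le_linear by blast
  then show ?case
  proof cases
    case 1
    then have "is_least m (insert x X)" using m by (auto simp: is_least_def)
    then show ?thesis ..
  next
    case 2
    then have "is_least x (insert x X)"
      using m le_trans le_refl \<open>x \<in> carrier H\<close> by (auto simp: is_least_def)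
    then show ?thesis ..
  qed
qed

lemma is_least_least: "X \<in> carrier (power_monoid H) \<Longrightarrow> is_least (least X) X"
  using ex_is_least[of X] least_eqI by (auto simp: carrier_power_monoid)

lemma least_mem: "X \<in> carrier (power_monoid H) \<Longrightarrow> least X \<in> X"
  using is_least_least by (simp add: is_least_def)

lemma least_closed: "X \<in> carrier (power_monoid H) \<Longrightarrow> least X \<in> carrier H"
  using least_mem by (auto simp: carrier_power_monoid)

text \<open>Multiplication is monotone in each argument, so replacing both factors by the least ones
  can only lower a product. Thus \<open>least\<close> is multiplicative from the power monoid to
  \<open>H\<close>.\<close>

lemma least_mult:
  assumes X: "X \<in> carrier (power_monoid H)" and Y: "Y \<in> carrier (power_monoid H)"
  shows "least (X <#> Y) = least X \<otimes> least Y"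
proof (rule least_eqI, unfold is_least_def, intro conjI ballI)
  show "least X \<otimes> least Y \<in> X <#> Y"
    using least_mem[OF X] least_mem[OF Y] by (auto simp: set_mult_def)
  fix z assume "z \<in> X <#> Y"
  then obtain x y where xy: "x \<in> X" "y \<in> Y" and z: "z = x \<otimes> y"
    by (auto simp: set_mult_def)
  have "(least X, x) \<in> r" "(least Y, y) \<in> r"
    using xy is_least_least[OF X] is_least_least[OF Y] by (auto simp: is_least_def)
  moreover have "x \<in> carrier H" "y \<in> carrier H"
    using xy X Y by (auto simp: carrier_power_monoid)
  ultimately show "(least X \<otimes> least Y, z) \<in> r"
    unfolding z using least_closed X Y
    by (blast intro: le_trans right_mono left_mono)
qed

section \<open>The cardinality bound for product sets\<close>

lemma card_set_mult_ge:
  assumes X: "X \<in> carrier (power_monoid H)" and Y: "Y \<in> carrier (power_monoid H)"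
  shows "card X + card Y - 1 \<le> card (X <#> Y)"
proof -
  interpret conv: linearly_ordered_monoid H "r\<inverse>" by (rule linearly_ordered_converse)
  have XY: "X \<subseteq> carrier H" "Y \<subseteq> carrier H" "finite X" "finite Y"
    using X Y by (auto simp: carrier_power_monoid)
  \<comment> \<open>As the least element for the reversed order, \<open>a\<close> is the maximum of
    \<open>X\<close>.\<close>
  define a where "a = conv.least X"
  define b where "b = least Y"
  have a: "a \<in> X" "a \<in> carrier H" "\<And>x. x \<in> X \<Longrightarrow> (x, a) \<in> r"
    using conv.is_least_least[OF X] XY by (auto simp: a_def conv.is_least_def)
  have b: "b \<in> Y" "b \<in> carrier H" "\<And>y. y \<in> Y \<Longrightarrow> (b, y) \<in> r"
    using is_least_least[OF Y] XY by (auto simp: b_def is_least_def)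
  let ?A = "(\<lambda>x. x \<otimes> b) ` X" and ?B = "(\<lambda>y. a \<otimes> y) ` Y"
  have "inj_on (\<lambda>x. x \<otimes> b) X"
    using XY b(2) right_cancel by (meson inj_onI subsetD)
  moreover have "inj_on (\<lambda>y. a \<otimes> y) Y"
    using XY a(2) left_cancel by (meson inj_onI subsetD)
  ultimately have "card ?A = card X" "card ?B = card Y"
    by (simp_all add: card_image)
  \<comment> \<open>All of \<open>?A\<close> lies at or below \<open>a \<otimes> b\<close> and all
    of \<open>?B\<close> at or above it, so the two copies overlap in at most this point.\<close>
  moreover have "?A \<inter> ?B \<subseteq> {a \<otimes> b}"
  proof
    fix z assume "z \<in> ?A \<inter> ?B"
    then obtain x y where xy: "x \<in> X" "y \<in> Y" and z: "z = x \<otimes> b" "z = a \<otimes> y" by auto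
    have "(z, a \<otimes> b) \<in> r"
      unfolding z(1) using xy a b XY by (intro right_mono) auto
    moreover have "(a \<otimes> b, z) \<in> r"
      unfolding z(2) using xy a b XY by (intro left_mono) auto
    ultimately show "z \<in> {a \<otimes> b}"
      using le_antisym by blast
  qed
  then have "card (?A \<inter> ?B) \<le> 1"
    using card_mono[of "{a \<otimes> b}" "?A \<inter> ?B"] by simp
  moreover have "card ?A + card ?B = card (?A \<union> ?B) + card (?A \<inter> ?B)"
    using XY by (intro card_Un_Int) auto
  moreover have "card (?A \<union> ?B) \<le> card (X <#> Y)"
    using a b XY by (intro card_mono finite_set_mult) (auto simp: set_mult_def)
  ultimately show ?thesis by linarith
qed

section \<open>Strong unit-cancellativity\<close>

lemma card_pos: "X \<in> carrier (power_monoid H) \<Longrightarrow> 0 < card X"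
  by (simp add: carrier_power_monoid card_gt_0_iff)

lemma eq_singleton_of_card_le_1:
  assumes "X \<in> carrier (power_monoid H)" "card X \<le> 1"
  obtains x where "X = {x}" "x \<in> carrier H"
proof -
  have "card X = 1" using card_pos[OF assms(1)] assms(2) by simp
  then obtain x where "X = {x}" by (auto simp: card_1_singleton_iff)
  then show ?thesis using that assms(1) singleton_in_power_monoid by blast
qed

text \<open>The cardinality bound forces \<open>Y\<close> to be a singleton. Taking least elements
  then turns the equation of sets into one in \<open>H\<close>, where \<open>least X\<close>
  cancels.\<close>

lemma strongly_unit_cancellative_power_monoid:
  "strongly_unit_cancellative (power_monoid H)"
  unfolding strongly_unit_cancellative_def
proof (intro ballI impI)
  fix X Y
  assume X: "X \<in> carrier (power_monoid H)" and Y: "Y \<in> carrier (power_monoid H)"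
    and "X \<otimes>\<^bsub>power_monoid H\<^esub> Y = X \<or> Y \<otimes>\<^bsub>power_monoid H\<^esub> X = X"
  then have eq: "X <#> Y = X \<or> Y <#> X = X" by simp
  then have "card Y \<le> 1"
    using card_set_mult_ge[OF X Y] card_set_mult_ge[OF Y X] card_pos[OF X] by auto
  then obtain y where y: "Y = {y}" "y \<in> carrier H"
    using eq_singleton_of_card_le_1[OF Y] by blast
  have "least Y = y"
    by (rule least_eqI) (use y le_refl in \<open>auto simp: is_least_def\<close>)
  then have "least X \<otimes> y = least X \<or> y \<otimes> least X = least X"
    using eq least_mult[OF X Y] least_mult[OF Y X] by auto
  then have "y = \<one>"
    using left_cancel[of y \<one> "least X"] right_cancel[of y \<one> "least X"] y least_closed[OF X] by auto
  then show "Y = \<one>\<^bsub>power_monoid H\<^esub>" using y by simp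
qed

lemma strongly_unit_cancellative_restricted_power_monoid:
  "strongly_unit_cancellative (restricted_power_monoid H)"
  using strongly_unit_cancellative_power_monoid
  unfolding strongly_unit_cancellative_def carrier_restricted_power_monoid Ball_def
    power_monoid_simps by blast

lemma superadditive_length_restricted_power_monoid:
  "superadditive_length (restricted_power_monoid H) (\<lambda>X. card X - 1)"
proof -
  have "(card X - 1) + (card Y - 1) \<le> card (X <#> Y) - 1"
    if "X \<in> carrier (power_monoid H)" "Y \<in> carrier (power_monoid H)" for X Y
    using card_set_mult_ge[OF that] card_pos[OF that(1)] card_pos[OF that(2)] by simp
  moreover have "0 < card X - 1"
    if X: "X \<in> carrier (restricted_power_monoid H)"
      and nonunit: "X \<notin> Units (restricted_power_monoid H)" for X
  \<comment> \<open>Members are nonempty, so the truncated difference is 0 only for singletons, and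
    a singleton that meets the units of \<open>H\<close> is invertible.\<close>
  proof (rule ccontr)
    assume "\<not> 0 < card X - 1"
    then obtain x where "X = {x}"
      using X eq_singleton_of_card_le_1[of X] by (auto simp: carrier_restricted_power_monoid)
    then show False
      using X nonunit singleton_unit_power_monoid(2) by (auto simp: carrier_restricted_power_monoid)
  qed
  ultimately show ?thesis
    by (auto simp: superadditive_length_def carrier_restricted_power_monoid)
qed

section \<open>Transfer of the BF property\<close>

lemma unit_of_singleton_unit:
  assumes "{x} \<in> Units (power_monoid H)"
  shows "x \<in> Units H"
proof -
  obtain Y where Y: "Y \<in> carrier (power_monoid H)" "Y <#> {x} = {\<one>}" "{x} <#> Y = {\<one>}"
    and x: "x \<in> carrier H"
    using assms by (auto simp: Units_def singleton_in_power_monoid)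
  \<comment> \<open>Any element of the inverse set will do, because all products with
    \<open>x\<close> lie in \<open>{\<one>}\<close>.\<close>
  obtain y where "y \<in> Y" "y \<in> carrier H"
    using Y(1) by (auto simp: carrier_power_monoid)
  then have "y \<otimes> x = \<one>" "x \<otimes> y = \<one>"
    using Y(2,3) by (auto simp: set_mult_def)
  then show ?thesis
    using x \<open>y \<in> carrier H\<close> by (auto simp: Units_def)
qed

lemma units_of_set_mult_unit:
  assumes X: "X \<in> carrier (power_monoid H)" and Y: "Y \<in> carrier (power_monoid H)"
    and XY: "X <#> Y \<in> Units (power_monoid H)"
  shows "X \<in> Units (power_monoid H) \<and> Y \<in> Units (power_monoid H)"
proof -
  have carr: "X <#> Y \<in> carrier (power_monoid H)"
    using XY by (auto simp: Units_def)
  obtain Z where Z: "Z \<in> carrier (power_monoid H)" "(X <#> Y) <#> Z = {\<one>}"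
    using XY by (auto simp: Units_def)
  \<comment> \<open>The product with \<open>Z\<close> has one element, so the cardinality bound
    leaves room for only one in \<open>X <#> Y\<close>, and then for only one in each of
    \<open>X\<close> and \<open>Y\<close>.\<close>
  have "card (X <#> Y) \<le> 1"
    using card_set_mult_ge[OF carr Z(1)] Z(2) card_pos[OF Z(1)] by simp
  then have "card X \<le> 1" "card Y \<le> 1"
    using card_set_mult_ge[OF X Y] card_pos[OF X] card_pos[OF Y] by auto
  then obtain x y where xy: "X = {x}" "Y = {y}" "x \<in> carrier H" "y \<in> carrier H"
    using eq_singleton_of_card_le_1 X Y by metis
  then have "x \<otimes> y \<in> Units H"
    using XY unit_of_singleton_unit by simp
  then show ?thesis
    using units_of_mult_unit[OF xy(3,4)] singleton_unit_power_monoid(1) xy(1,2) by simp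
qed

text \<open>The cardinality term alone vanishes at \<open>{x}\<close> for a nonunit
  \<open>x\<close>, and the term \<open>f (least X)\<close> makes up for this. Each term is
  superadditive, by \<open>card_set_mult_ge\<close> and \<open>least_mult\<close>
  respectively.\<close>

lemma superadditive_length_power_monoid:
  assumes f: "superadditive_length H f"
  shows "superadditive_length (power_monoid H) (\<lambda>X. card X - 1 + f (least X))"
proof -
  have "(card X - 1 + f (least X)) + (card Y - 1 + f (least Y)) \<le>
      card (X <#> Y) - 1 + f (least (X <#> Y))"
    if XY: "X \<in> carrier (power_monoid H)" "Y \<in> carrier (power_monoid H)" for X Y
    using card_set_mult_ge[OF XY] card_pos[OF XY(1)] card_pos[OF XY(2)] least_mult[OF XY]
      superadditive_lengthD(1)[OF f least_closed[OF XY(1)] least_closed[OF XY(2)]] by simp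
  moreover have "0 < card X - 1 + f (least X)"
    if X: "X \<in> carrier (power_monoid H)" and nonunit: "X \<notin> Units (power_monoid H)" for X
  proof (cases "card X \<le> 1")
    case True
    then obtain x where "X = {x}" "x \<in> carrier H"
      using eq_singleton_of_card_le_1[OF X] by blast
    then have "least X \<notin> Units H"
      using nonunit singleton_unit_power_monoid(1) least_mem[OF X] by auto
    then show ?thesis
      using superadditive_lengthD(2)[OF f least_closed[OF X]] by simp
  qed simp
  ultimately show ?thesis
    by (auto simp: superadditive_length_def)
qed

text \<open>The embedding of \<open>x\<close> as \<open>{x}\<close> is multiplicative and sends
  nonunits to nonunits.\<close>

lemma superadditive_length_singletons:
  assumes f: "superadditive_length (power_monoid H) f"
  shows "superadditive_length H (\<lambda>x. f {x})"
  unfolding superadditive_length_def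
  using superadditive_lengthD(1)[OF f, of "{x}" "{y}" for x y]
    superadditive_lengthD(2)[OF f, of "{x}" for x] unit_of_singleton_unit
  by (auto simp: singleton_in_power_monoid)

text \<open>In both monoids divisors of units are units, so BF amounts to the existence of a
  superadditive length, and such lengths pass in both directions.\<close>

lemma BF_power_monoid_iff: "BF_monoid (power_monoid H) \<longleftrightarrow> BF_monoid H"
proof -
  interpret P: monoid "power_monoid H" by (rule monoid_power_monoid)
  show ?thesis
  proof
    assume "BF_monoid (power_monoid H)"
    then obtain f where "superadditive_length (power_monoid H) f"
      using P.BF_imp_superadditive_length units_of_set_mult_unit by auto
    then show "BF_monoid H"
      using superadditive_length_singletons superadditive_length_imp_BF by blast
  next
    assume "BF_monoid H"
    then obtain f where "superadditive_length H f"
      using BF_imp_superadditive_length units_of_mult_unit by blast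
    then show "BF_monoid (power_monoid H)"
      using superadditive_length_power_monoid P.superadditive_length_imp_BF by blast
  qed
qed

end

theorem proposition3p5:
  fixes H :: "('a, 'b) monoid_scheme"
  assumes "monoid H" and "linearly_orderable H"
  shows "(\<forall>X \<in> carrier (power_monoid H). \<forall>Y \<in> carrier (power_monoid H).
            card (X <#>\<^bsub>H\<^esub> Y) \<ge> card X + card Y - 1) \<and>
         (monoid (power_monoid H) \<and> strongly_unit_cancellative (power_monoid H) \<and>
          monoid (restricted_power_monoid H) \<and>
          strongly_unit_cancellative (restricted_power_monoid H)) \<and>
         (length_function (restricted_power_monoid H) (\<lambda>X. card X - 1) \<and>
          BF_monoid (restricted_power_monoid H)) \<and>
         (BF_monoid (power_monoid H) \<longleftrightarrow> BF_monoid H)"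
proof -
  \<comment> \<open>The strict monotonicity demanded of the witness order is the pair of locale
    axioms \<open>mult_right\<close> and \<open>mult_left\<close>.\<close>
  obtain r where "linearly_ordered_monoid H r"
    using assms unfolding linearly_orderable_def linearly_ordered_monoid_def
      linearly_ordered_monoid_axioms_def by blast
  then interpret linearly_ordered_monoid H r .
  interpret R: monoid "restricted_power_monoid H" by (rule monoid_restricted_power_monoid)
  show ?thesis
    by (intro conjI ballI card_set_mult_ge monoid_power_monoid monoid_restricted_power_monoid
        strongly_unit_cancellative_power_monoid strongly_unit_cancellative_restricted_power_monoid
        R.superadditive_length_imp_length_function
        R.superadditive_length_imp_BF[OF superadditive_length_restricted_power_monoid]
        superadditive_length_restricted_power_monoid BF_power_monoid_iff)
qed

end
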